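(* Let $f(x) = 4 - (x+1)^2$. For positive integers $p$ let $M_p = \int_0^1 f(x)^p\,dx$, let $L(f) = \limsup_{p\to\infty} |M_p|^{1/p}$, and let $\mathcal{S} = \{f(z) : z \in \mathbb{C},\ f'(z) = 0\} \cup \{f(0), f(1)\}$. Then $L(f) \leq 3$, but $\max\{|s| : s \in \mathcal{S}\} = 4$.
   Context: The polynomial $f$ is regarded as a function on $\mathbb{C}$ in the definition of $\mathcal{S}$, and $f'$ denotes its (complex) derivative. The moments $M_p$ are taken over the real interval $[0,1]$. *)

theory Defs
  imports "HOL-Analysis.Analysis"
begin

definition f :: "complex \<Rightarrow> complex" where
  "f z = 4 - (z + 1)\<^sup>2"

definition moment :: "(complex \<Rightarrow> complex) \<Rightarrow> nat \<Rightarrow> complex" where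
  "moment g p = integral {0..1::real} (\<lambda>x. g (of_real x) ^ p)"

(* The limsup is taken in the extended reals, so that it is meaningful without a
   boundedness proof; the junk value root 0 _ = 0 at p = 0 does not affect it. *)
definition moment_growth :: "(complex \<Rightarrow> complex) \<Rightarrow> ereal" where
  "moment_growth g = limsup (\<lambda>p. ereal (root p (norm (moment g p))))"

definition special_values :: "(complex \<Rightarrow> complex) \<Rightarrow> complex set" where
  "special_values g = {g z |z. deriv g z = 0} \<union> {g 0, g 1}"

end

theory Submission
  imports Defs
begin

text \<open>
  The gap between the two values comes from the location of the critical point. The moments only
  see the unit interval, so \<open>moment_growth g\<close> never exceeds the supremum of \<open>norm (g x)\<close> there
  (\<open>moment_growth_le\<close>). Here \<open>f\<close> decreases from \<open>3\<close> to \<open>0\<close> on \<open>[0, 1]\<close>, which gives the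
  bound \<open>3\<close>. The only critical point of \<open>f\<close> is \<open>-1\<close>, outside the interval, and its critical
  value \<open>4\<close> dominates both endpoint values (\<open>special_values_f\<close>).
\<close>

lemma norm_moment_le:
  fixes g :: "complex \<Rightarrow> complex"
  assumes cont: "continuous_on {0..1::real} (\<lambda>x. g (of_real x))"
    and bound: "\<And>x. x \<in> {0..1::real} \<Longrightarrow> norm (g (of_real x)) \<le> B"
  shows "norm (moment g p) \<le> B ^ p"
proof -
  have "norm (integral {0..1::real} (\<lambda>x. g (of_real x) ^ p)) \<le> B ^ p * (1 - 0)"
  proof (rule integral_bound)
    show "continuous_on {0..1::real} (\<lambda>x. g (of_real x) ^ p)"
      using cont by (intro continuous_intros)
    show "norm (g (of_real x) ^ p) \<le> B ^ p" if "x \<in> {0..1}" for x :: real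
      using bound[OF that] by (simp add: norm_power power_mono)
  qed simp
  then show ?thesis
    by (simp add: moment_def)
qed

lemma moment_growth_le:
  fixes g :: "complex \<Rightarrow> complex"
  assumes cont: "continuous_on {0..1::real} (\<lambda>x. g (of_real x))"
    and bound: "\<And>x. x \<in> {0..1::real} \<Longrightarrow> norm (g (of_real x)) \<le> B"
  shows "moment_growth g \<le> ereal B"
proof -
  have B: "0 \<le> B"
    using order_trans[OF norm_ge_zero bound[of 0]] by simp
  have "root p (norm (moment g p)) \<le> B" for p
  proof (cases "p = 0")
    case False
    then have "root p (norm (moment g p)) \<le> root p (B ^ p)"
      using norm_moment_le[OF cont bound] by simp
    with False B show ?thesis
      by (simp add: real_root_power_cancel)
  qed (use B in simp)
  then show ?thesis
    unfolding moment_growth_def by (intro Limsup_bounded always_eventually) simp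
qed

lemma norm_f_le_3:
  assumes "x \<in> {0..1::real}"
  shows "norm (f (of_real x)) \<le> 3"
proof -
  have "1 \<le> (x + 1)\<^sup>2"
    using assms by (intro one_le_power) simp
  moreover have "(x + 1)\<^sup>2 \<le> 2\<^sup>2"
    using assms by (intro power_mono) simp_all
  moreover have "norm (f (of_real x)) = \<bar>4 - (x + 1)\<^sup>2\<bar>"
  proof -
    have "f (of_real x) = of_real (4 - (x + 1)\<^sup>2)"
      by (simp add: f_def)
    then show ?thesis
      by (metis norm_of_real)
  qed
  ultimately show ?thesis
    by simp
qed

lemma deriv_f: "deriv f z = - 2 * (z + 1)"
proof (rule DERIV_imp_deriv)
  show "(f has_field_derivative - 2 * (z + 1)) (at z)"
    unfolding f_def by (auto intro!: derivative_eq_intros)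
qed

lemma special_values_f: "special_values f = {4, 3, 0}"
proof -
  have "deriv f z = 0 \<longleftrightarrow> z = - 1" for z
    unfolding deriv_f by (simp only: mult_eq_0_iff eq_neg_iff_add_eq_0) simp
  then have "{f z |z. deriv f z = 0} = {f (- 1)}"
    by simp
  then show ?thesis
    by (simp add: special_values_def f_def insert_commute)
qed

theorem proposition2:
  shows "moment_growth f \<le> 3 \<and>
    finite (special_values f) \<and> Max (norm ` special_values f) = 4"
proof -
  have "continuous_on {0..1::real} (\<lambda>x. f (of_real x))"
    unfolding f_def by (intro continuous_intros)
  then have "moment_growth f \<le> ereal 3"
    using norm_f_le_3 by (rule moment_growth_le)
  then show ?thesis
    by (simp add: special_values_f)
qed

end
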